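(* Let $S$ and $T$ be disjoint non-empty finite sets. Let $H_0=(S,T;F_0)$ be a simple bipartite graph and let $G_0$ be its bipartite complement. Let $M_S=(S,r_S)$ be a matroid on $S$, let $p_T$ be an integer-valued fully supermodular set-function on $T$, and let $m_V=(m_S,m_T)$ be a degree-specification (non-negative integers) on $S\cup T$ with $\widetilde m_S(S)=\widetilde m_T(T)=\gamma$. Then there exists a bipartite graph $G=(S,T;E)$ fitting $m_V$ for which $G^+=G+H_0$ is simple and $M_S$-covers $p_T$ if and only if both $$\widetilde m_S(X)+\widetilde m_T(Y)-d_{G_0}(X,Y)\le\gamma\quad\text{for all } X\subseteq S,\ Y\subseteq T,$$ and $$\widetilde m_S(X)+\widetilde m_T(Y)-d_{G_0}(X,Y)+p_T(T_0)-r_S(X\cup\Gamma_{H_0}(T_0))\le\gamma\quad\text{for all } X\subseteq S,\ Y\subseteq T,\ T_0\subseteq T-Y.$$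
   Context: A bipartite graph (bigraph) $G=(S,T;E)$ has all edges between $S$ and $T$; parallel edges are a priori allowed, and $G$ is simple if it has none. The bipartite complement of a simple bigraph $H_0=(S,T;F_0)$ is $G_0=(S,T;E_0)$ where $E_0$ consists of all pairs $st$ ($s\in S,t\in T$) not in $F_0$; $G+H_0$ denotes the bigraph with edge set $E\cup F_0$. $d_{G_0}(X,Y)$ is the number of edges of $G_0$ joining $X\subseteq S$ and $Y\subseteq T$. $\Gamma_H(Y)$ is the set of neighbours in $S$ of $Y\subseteq T$ in the bigraph $H$. $\widetilde m(Z)=\sum_{v\in Z}m(v)$. $G$ fits $m_V$ if $d_G(v)=m_V(v)$ for all $v\in S\cup T$. A set-function $p$ on $T$ is fully supermodular if $p(A)+p(B)\le p(A\cap B)+p(A\cup B)$ for all $A,B\subseteq T$. $G$ $M_S$-covers $p_T$ if $r_S(\Gamma_G(Y))\ge p_T(Y)$ for every $Y\subseteq T$, where $r_S$ is the rank function of $M_S$. *)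

theory Defs
  imports Complex_Main "HOL-Library.Multiset"
begin

text \<open>
  A bigraph with classes S and T is given by the multiset of its edges, an edge joining
  s in S and t in T being the pair (s, t); multiplicities count parallel edges.
\<close>

type_synonym 'a edges = "('a \<times> 'a) multiset"

definition bigraph :: "'a set \<Rightarrow> 'a set \<Rightarrow> 'a edges \<Rightarrow> bool" where
  "bigraph S T E \<longleftrightarrow> set_mset E \<subseteq> S \<times> T"

definition simple :: "'a edges \<Rightarrow> bool" where
  "simple E \<longleftrightarrow> (\<forall>e. count E e \<le> 1)"

definition bip_complement :: "'a set \<Rightarrow> 'a set \<Rightarrow> 'a edges \<Rightarrow> 'a edges" where
  "bip_complement S T F = mset_set (S \<times> T - set_mset F)"

definition edges_between :: "'a edges \<Rightarrow> 'a set \<Rightarrow> 'a set \<Rightarrow> nat" where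
  "edges_between E X Y = size {# e \<in># E. fst e \<in> X \<and> snd e \<in> Y #}"

definition degree :: "'a edges \<Rightarrow> 'a \<Rightarrow> nat" where
  "degree E v = size {# e \<in># E. fst e = v \<or> snd e = v #}"

definition neighbours :: "'a edges \<Rightarrow> 'a set \<Rightarrow> 'a set" where
  "neighbours E Y = {s. \<exists>t\<in>Y. (s, t) \<in># E}"

definition fits :: "'a set \<Rightarrow> 'a set \<Rightarrow> 'a edges \<Rightarrow> ('a \<Rightarrow> nat) \<Rightarrow> ('a \<Rightarrow> nat) \<Rightarrow> bool" where
  "fits S T E m\<^sub>S m\<^sub>T \<longleftrightarrow> (\<forall>s\<in>S. degree E s = m\<^sub>S s) \<and> (\<forall>t\<in>T. degree E t = m\<^sub>T t)"

text \<open>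
  The matroid (S, r) is given by its rank function r, subject to the usual rank axioms;
  the values of r outside the subsets of S are irrelevant.
\<close>

definition matroid :: "'a set \<Rightarrow> ('a set \<Rightarrow> nat) \<Rightarrow> bool" where
  "matroid S r \<longleftrightarrow> finite S
     \<and> (\<forall>X. X \<subseteq> S \<longrightarrow> r X \<le> card X)
     \<and> (\<forall>X Y. X \<subseteq> Y \<longrightarrow> Y \<subseteq> S \<longrightarrow> r X \<le> r Y)
     \<and> (\<forall>X Y. X \<subseteq> S \<longrightarrow> Y \<subseteq> S \<longrightarrow> r (X \<inter> Y) + r (X \<union> Y) \<le> r X + r Y)"

definition fully_supermodular :: "'a set \<Rightarrow> ('a set \<Rightarrow> int) \<Rightarrow> bool" where
  "fully_supermodular T p \<longleftrightarrow>
     (\<forall>A B. A \<subseteq> T \<longrightarrow> B \<subseteq> T \<longrightarrow> p A + p B \<le> p (A \<inter> B) + p (A \<union> B))"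

definition matroid_covers :: "('a set \<Rightarrow> nat) \<Rightarrow> 'a set \<Rightarrow> 'a edges \<Rightarrow> ('a set \<Rightarrow> int) \<Rightarrow> bool" where
  "matroid_covers r T E p \<longleftrightarrow> (\<forall>Y. Y \<subseteq> T \<longrightarrow> int (r (neighbours E Y)) \<ge> p Y)"

end

theory Submission imports Defs
begin

text \<open>
  Adding an edge \<open>st\<close> of \<open>G\<close> to \<open>H\<^sub>0\<close> and lowering \<open>m\<^sub>S s\<close>, \<open>m\<^sub>T t\<close> and \<open>\<gamma>\<close> by one gives an instance
  of the same problem, so both directions go by induction on the number of edges of \<open>G\<close>.
  The slack \<open>h(X,Y) = \<gamma> - m\<^sub>S(X) - m\<^sub>T(Y) + d(X,Y)\<close>, with \<open>d\<close> counted in \<open>G\<^sub>0\<close>, drops by one exactly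
  when \<open>s \<notin> X\<close> and \<open>t \<notin> Y\<close>, and it is submodular for the operations
  \<open>(X \<union> X', Y \<inter> Y')\<close> and \<open>(X \<inter> X', Y \<union> Y')\<close>. For sufficiency fix \<open>s\<close> with \<open>m\<^sub>S s > 0\<close>; an edge \<open>st\<close> is
  only blocked by tight pairs (\<open>h(X,Y) = 0\<close>) or tight triples (\<open>h(X,Y) = p(T\<^sub>0) - r(X \<union> \<Gamma>(T\<^sub>0))\<close>).
  Tight pairs and tight triples can be uncrossed with themselves and with each other, so that
  a suitable extremal tight set exhibits a vertex \<open>t\<close> for which \<open>st\<close> is not blocked.
\<close>

section \<open>The slack of a pair and its uncrossing\<close>

text \<open>\<open>F\<close> is the edge set of H_0, so \<open>X \<times> Y - F\<close> consists of
  the edges of G_0 between \<open>X\<close> and \<open>Y\<close>.\<close>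

definition slack ::
    "('a \<times> 'a) set \<Rightarrow> ('a \<Rightarrow> nat) \<Rightarrow> ('a \<Rightarrow> nat) \<Rightarrow> nat \<Rightarrow> 'a set \<Rightarrow> 'a set \<Rightarrow> int" where
  "slack F mS mT g X Y = int g - (\<Sum>s\<in>X. int (mS s)) - (\<Sum>t\<in>Y. int (mT t)) + int (card (X \<times> Y - F))"

lemma card_rectangle_diff:
  assumes "finite S" "finite T" "X \<subseteq> S" "Y \<subseteq> T"
  shows "int (card (X \<times> Y - F)) = (\<Sum>e\<in>S \<times> T - F. of_bool (fst e \<in> X \<and> snd e \<in> Y))"
proof -
  have "(S \<times> T - F) \<inter> {e. fst e \<in> X \<and> snd e \<in> Y} = X \<times> Y - F"
    using assms by auto
  then show ?thesis
    using assms by (simp add: sum_of_bool_eq)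
qed

text \<open>The vertex sums are modular. A pair in \<open>(X - X') \<times> (Y - Y')\<close> or
  \<open>(X' - X) \<times> (Y' - Y)\<close> lies in one rectangle on the left but in neither on the
  right; all other pairs are counted equally often.\<close>

lemma slack_uncross:
  assumes "finite S" "finite T" "X \<subseteq> S" "Y \<subseteq> T" "X' \<subseteq> S" "Y' \<subseteq> T"
  shows "slack F mS mT g X Y + slack F mS mT g X' Y' =
    slack F mS mT g (X \<inter> X') (Y \<union> Y') + slack F mS mT g (X \<union> X') (Y \<inter> Y')
    + int (card ((X - X') \<times> (Y - Y') - F)) + int (card ((X' - X) \<times> (Y' - Y) - F))"
proof -
  have fin: "finite X" "finite X'" "finite Y" "finite Y'"
    using assms by (auto intro: finite_subset)
  have sub: "X \<inter> X' \<subseteq> S" "Y \<union> Y' \<subseteq> T" "X \<union> X' \<subseteq> S" "Y \<inter> Y' \<subseteq> T"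
    "X - X' \<subseteq> S" "Y - Y' \<subseteq> T" "X' - X \<subseteq> S" "Y' - Y \<subseteq> T"
    using assms by auto
  note c = card_rectangle_diff[OF assms(1,2), of _ _ F]
  have "int (card (X \<times> Y - F)) + int (card (X' \<times> Y' - F)) =
    int (card ((X \<inter> X') \<times> (Y \<union> Y') - F)) + int (card ((X \<union> X') \<times> (Y \<inter> Y') - F))
    + int (card ((X - X') \<times> (Y - Y') - F)) + int (card ((X' - X) \<times> (Y' - Y) - F))"
    unfolding c[OF assms(3,4)] c[OF assms(5,6)] c[OF sub(1,2)] c[OF sub(3,4)]
      c[OF sub(5,6)] c[OF sub(7,8)] sum.distrib[symmetric]
    by (rule sum.cong[OF refl]) (simp add: of_bool_def)
  moreover have "(\<Sum>s\<in>X. int (mS s)) + (\<Sum>s\<in>X'. int (mS s)) =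
      (\<Sum>s\<in>X \<union> X'. int (mS s)) + (\<Sum>s\<in>X \<inter> X'. int (mS s))"
    using sum.union_inter[OF fin(1,2)] by metis
  moreover have "(\<Sum>s\<in>Y. int (mT s)) + (\<Sum>s\<in>Y'. int (mT s)) =
      (\<Sum>s\<in>Y \<union> Y'. int (mT s)) + (\<Sum>s\<in>Y \<inter> Y'. int (mT s))"
    using sum.union_inter[OF fin(3,4)] by metis
  ultimately show ?thesis
    unfolding slack_def by linarith
qed

lemma sum_decrement:
  assumes "finite A" "0 < f x"
  shows "(\<Sum>a\<in>A. int ((f(x := f x - 1)) a)) = (\<Sum>a\<in>A. int (f a)) - of_bool (x \<in> A)"
proof (cases "x \<in> A")
  case True
  then show ?thesis
    using assms by (simp add: sum.remove[of A x])
next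
  case False
  then have "(\<Sum>a\<in>A. int ((f(x := f x - 1)) a)) = (\<Sum>a\<in>A. int (f a))"
    by (intro sum.cong) auto
  then show ?thesis
    using False by simp
qed

text \<open>\<open>g\<close> contributes -1, each degree sum containing its end of st contributes
  +1, and the edge count -1 if both ends are inside; the total is -1 exactly when both ends are
  outside.\<close>

lemma slack_insert:
  assumes "finite X" "finite Y" "(s, t) \<notin> F" "0 < mS s" "0 < mT t" "0 < g"
  shows "slack (insert (s, t) F) (mS(s := mS s - 1)) (mT(t := mT t - 1)) (g - 1) X Y
    = slack F mS mT g X Y - of_bool (s \<notin> X \<and> t \<notin> Y)"
proof -
  have "finite (X \<times> Y - F)"
    using assms(1,2) by simp
  then have "card (X \<times> Y - F) = card ((X \<times> Y - F) - {(s, t)}) + of_bool ((s, t) \<in> X \<times> Y - F)"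
    using card.remove[of "X \<times> Y - F" "(s, t)"] by (cases "(s, t) \<in> X \<times> Y - F") simp_all
  moreover have "X \<times> Y - insert (s, t) F = (X \<times> Y - F) - {(s, t)}"
    by auto
  ultimately have "int (card (X \<times> Y - insert (s, t) F)) =
      int (card (X \<times> Y - F)) - of_bool ((s, t) \<in> X \<times> Y - F)"
    by simp
  then show ?thesis
    unfolding slack_def sum_decrement[of X mS s, OF assms(1,4)] sum_decrement[of Y mT t, OF assms(2,5)]
    using assms(3,6) by (auto simp: of_nat_diff)
qed

section \<open>Matroid rank and the feasibility conditions\<close>

locale matroid_supermodular =
  fixes S T :: "'a set" and r :: "'a set \<Rightarrow> nat" and p :: "'a set \<Rightarrow> int"
  assumes fin_S: "finite S" and fin_T: "finite T"
    and matroid: "matroid S r" and supermodular: "fully_supermodular T p"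
begin

lemma rank_mono: "X \<subseteq> Y \<Longrightarrow> Y \<subseteq> S \<Longrightarrow> r X \<le> r Y"
  using matroid unfolding matroid_def by blast

lemma rank_submodular: "X \<subseteq> S \<Longrightarrow> Y \<subseteq> S \<Longrightarrow> r (X \<inter> Y) + r (X \<union> Y) \<le> r X + r Y"
  using matroid unfolding matroid_def by blast

lemma rank_Un_le:
  assumes "X \<subseteq> S" "Z \<subseteq> S"
  shows "r (X \<union> Z) \<le> r X + card Z"
proof -
  have "r Z \<le> card Z"
    using matroid assms unfolding matroid_def by blast
  then show ?thesis
    using rank_submodular[OF assms] by linarith
qed

text \<open>Matroid closure is monotone: submodularity is applied to \<open>insert s A\<close> and
  \<open>B\<close>, whose intersection contains \<open>A\<close>.\<close>

lemma rank_insert_eq_mono: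
  assumes "r (insert s A) = r A" "A \<subseteq> B" "B \<subseteq> S" "s \<in> S"
  shows "r (insert s B) = r B"
proof -
  have "r (insert s A \<inter> B) + r (insert s A \<union> B) \<le> r (insert s A) + r B"
    using assms by (intro rank_submodular) auto
  moreover have "insert s A \<union> B = insert s B"
    using assms by auto
  moreover have "r A \<le> r (insert s A \<inter> B)"
    using assms by (intro rank_mono) auto
  moreover have "r B \<le> r (insert s B)"
    using assms by (intro rank_mono) auto
  ultimately show ?thesis
    using assms(1) by auto
qed

text \<open>The two inequalities of the theorem, solved for the slack.\<close>

definition feasible :: "('a \<times> 'a) set \<Rightarrow> ('a \<Rightarrow> nat) \<Rightarrow> ('a \<Rightarrow> nat) \<Rightarrow> nat \<Rightarrow> bool" where
  "feasible F mS mT g \<longleftrightarrow>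
    (\<forall>X Y. X \<subseteq> S \<longrightarrow> Y \<subseteq> T \<longrightarrow> 0 \<le> slack F mS mT g X Y) \<and>
    (\<forall>X Y T0. X \<subseteq> S \<longrightarrow> Y \<subseteq> T \<longrightarrow> T0 \<subseteq> T - Y \<longrightarrow>
       p T0 - int (r (X \<union> F\<inverse> `` T0)) \<le> slack F mS mT g X Y)"

lemma feasibleD:
  assumes "feasible F mS mT g" "X \<subseteq> S" "Y \<subseteq> T"
  shows "0 \<le> slack F mS mT g X Y"
    and "T0 \<subseteq> T - Y \<Longrightarrow> p T0 - int (r (X \<union> F\<inverse> `` T0)) \<le> slack F mS mT g X Y"
  using assms unfolding feasible_def by blast+

text \<open>The edge raises the rank by at most one, and only if \<open>s \<notin> X\<close> and
  \<open>t \<in> T0\<close>. Then \<open>t \<notin> Y\<close>, so it also lowers the slack by one,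
  and removing it preserves the inequality.\<close>

lemma feasible_remove_edge:
  assumes feas: "feasible (insert (s, t) F) (mS(s := mS s - 1)) (mT(t := mT t - 1)) (g - 1)"
    and F: "F \<subseteq> S \<times> T" and st: "s \<in> S" "(s, t) \<notin> F" "0 < mS s" "0 < mT t" "0 < g"
  shows "feasible F mS mT g"
  unfolding feasible_def
proof (intro conjI allI impI)
  fix X Y assume XY: "X \<subseteq> S" "Y \<subseteq> T"
  then have "finite X" "finite Y"
    using fin_S fin_T finite_subset by auto
  note ins = slack_insert[of X Y s t F mS mT g, OF this st(2-)]
  show "0 \<le> slack F mS mT g X Y"
  proof -
    have "0 \<le> slack F mS mT g X Y - of_bool (s \<notin> X \<and> t \<notin> Y)"
      using feasibleD(1)[OF feas XY] unfolding ins .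
    then show ?thesis
      by (simp add: of_bool_def split: if_splits)
  qed
  fix T0 assume T0: "T0 \<subseteq> T - Y"
  have le: "p T0 - int (r (X \<union> (insert (s, t) F)\<inverse> `` T0)) \<le>
      slack F mS mT g X Y - of_bool (s \<notin> X \<and> t \<notin> Y)"
    using feasibleD(2)[OF feas XY T0] unfolding ins .
  show "p T0 - int (r (X \<union> F\<inverse> `` T0)) \<le> slack F mS mT g X Y"
  proof (cases "s \<notin> X \<and> t \<in> T0")
    case True
    have "X \<union> F\<inverse> `` T0 \<subseteq> S"
      using XY F by auto
    moreover have "X \<union> (insert (s, t) F)\<inverse> `` T0 = (X \<union> F\<inverse> `` T0) \<union> {s}"
      using True by auto
    ultimately have "r (X \<union> (insert (s, t) F)\<inverse> `` T0) \<le> r (X \<union> F\<inverse> `` T0) + 1"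
      using rank_Un_le[of "X \<union> F\<inverse> `` T0" "{s}"] st by simp
    moreover have "t \<notin> Y"
      using True T0 by auto
    ultimately show ?thesis
      using le True by simp
  next
    case False
    then have "X \<union> (insert (s, t) F)\<inverse> `` T0 = X \<union> F\<inverse> `` T0"
      by auto
    then show ?thesis
      using le by (simp add: of_bool_def split: if_splits)
  qed
qed

end

section \<open>Tight pairs and tight triples\<close>

locale feasible_instance = matroid_supermodular S T r p
  for S T :: "'a set" and r p +
  fixes F :: "('a \<times> 'a) set" and mS mT :: "'a \<Rightarrow> nat" and g :: nat
  assumes F: "F \<subseteq> S \<times> T"
    and feasible: "feasible F mS mT g"
    and sum_mS: "(\<Sum>s\<in>S. mS s) = g" and sum_mT: "(\<Sum>t\<in>T. mT t) = g"
begin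

abbreviation h :: "'a set \<Rightarrow> 'a set \<Rightarrow> int" where
  "h \<equiv> slack F mS mT g"

abbreviation \<Gamma> :: "'a set \<Rightarrow> 'a set" where
  "\<Gamma> A \<equiv> F\<inverse> `` A"

lemma \<Gamma>_subset: "\<Gamma> A \<subseteq> S"
  using F by auto

lemma slack_nonneg: "X \<subseteq> S \<Longrightarrow> Y \<subseteq> T \<Longrightarrow> 0 \<le> h X Y"
  using feasibleD(1)[OF feasible] .

lemma slack_ge: "X \<subseteq> S \<Longrightarrow> Y \<subseteq> T \<Longrightarrow> T0 \<subseteq> T - Y \<Longrightarrow> p T0 - int (r (X \<union> \<Gamma> T0)) \<le> h X Y"
  using feasibleD(2)[OF feasible] .

lemmas h_uncross = slack_uncross[OF fin_S fin_T, of _ _ _ _ F mS mT g]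

definition tight_pair :: "'a set \<Rightarrow> 'a set \<Rightarrow> bool" where
  "tight_pair X Y \<longleftrightarrow> X \<subseteq> S \<and> Y \<subseteq> T \<and> h X Y = 0"

definition tight_triple :: "'a set \<Rightarrow> 'a set \<Rightarrow> 'a set \<Rightarrow> bool" where
  "tight_triple X Y T0 \<longleftrightarrow>
    X \<subseteq> S \<and> Y \<subseteq> T \<and> T0 \<subseteq> T - Y \<and> h X Y = p T0 - int (r (X \<union> \<Gamma> T0))"

lemma tight_pair_uncross:
  assumes "tight_pair X Y" "tight_pair X' Y'"
  shows "tight_pair (X \<union> X') (Y \<inter> Y')"
proof -
  have sub: "X \<subseteq> S" "Y \<subseteq> T" "X' \<subseteq> S" "Y' \<subseteq> T" "X \<union> X' \<subseteq> S" "Y \<inter> Y' \<subseteq> T"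
    "X \<inter> X' \<subseteq> S" "Y \<union> Y' \<subseteq> T"
    using assms unfolding tight_pair_def by auto
  show ?thesis
    using h_uncross[OF sub(1-4)] slack_nonneg[OF sub(5,6)] slack_nonneg[OF sub(7,8)] assms sub
    unfolding tight_pair_def by auto
qed

text \<open>Slack and rank are submodular and \<open>p\<close> is supermodular, so the sum of the
  two tight equations leaves no room in the bounds for the uncrossed triples.\<close>

lemma tight_triple_uncross:
  assumes "tight_triple X Y T0" "tight_triple X' Y' T0'"
  shows "tight_triple (X \<union> X') (Y \<inter> Y') (T0 \<union> T0')"
    and "tight_triple (X \<inter> X') (Y \<union> Y') (T0 \<inter> T0')"
proof -
  have sub: "X \<subseteq> S" "Y \<subseteq> T" "X' \<subseteq> S" "Y' \<subseteq> T" "X \<union> X' \<subseteq> S" "Y \<inter> Y' \<subseteq> T"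
    "T0 \<union> T0' \<subseteq> T - (Y \<inter> Y')" "X \<inter> X' \<subseteq> S" "Y \<union> Y' \<subseteq> T" "T0 \<inter> T0' \<subseteq> T - (Y \<union> Y')"
    "T0 \<subseteq> T" "T0' \<subseteq> T"
    using assms unfolding tight_triple_def by auto
  have A: "X \<union> \<Gamma> T0 \<subseteq> S" "X' \<union> \<Gamma> T0' \<subseteq> S"
    using sub \<Gamma>_subset by auto
  have "r ((X \<union> \<Gamma> T0) \<inter> (X' \<union> \<Gamma> T0')) + r ((X \<union> \<Gamma> T0) \<union> (X' \<union> \<Gamma> T0'))
      \<le> r (X \<union> \<Gamma> T0) + r (X' \<union> \<Gamma> T0')"
    using rank_submodular[OF A] .
  moreover have "(X \<union> \<Gamma> T0) \<union> (X' \<union> \<Gamma> T0') = (X \<union> X') \<union> \<Gamma> (T0 \<union> T0')"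
    by auto
  \<comment> \<open>Only an inclusion: a common neighbour of \<open>T0\<close> and
    \<open>T0'\<close> need not be adjacent to \<open>T0 \<inter> T0'\<close>.\<close>
  moreover have "r ((X \<inter> X') \<union> \<Gamma> (T0 \<inter> T0')) \<le> r ((X \<union> \<Gamma> T0) \<inter> (X' \<union> \<Gamma> T0'))"
    using A by (intro rank_mono) auto
  moreover have "p T0 + p T0' \<le> p (T0 \<inter> T0') + p (T0 \<union> T0')"
    using supermodular sub unfolding fully_supermodular_def by blast
  ultimately show "tight_triple (X \<union> X') (Y \<inter> Y') (T0 \<union> T0')"
    "tight_triple (X \<inter> X') (Y \<union> Y') (T0 \<inter> T0')"
    using h_uncross[OF sub(1-4)] slack_ge[OF sub(5-7)] slack_ge[OF sub(8-10)] assms sub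
    unfolding tight_triple_def by auto
qed

text \<open>
  Here the rank may grow when \<open>X\<^sub>1\<close> is added to \<open>X\<close>, but a vertex \<open>t\<^sub>0 \<in> T\<^sub>0 \<inter> Y\<^sub>1\<close> supplies, for every
  new element \<open>x\<close>, an edge \<open>xt\<^sub>0\<close> of the surplus term in the uncrossing identity.
\<close>

lemma tight_triple_Un_pair:
  assumes "tight_triple X Y T0" "tight_pair X1 Y1" "T0 \<inter> Y1 \<noteq> {}"
  shows "tight_triple (X \<union> X1) (Y \<inter> Y1) T0"
proof -
  obtain t0 where t0: "t0 \<in> T0" "t0 \<in> Y1"
    using assms by auto
  have sub: "X \<subseteq> S" "Y \<subseteq> T" "X1 \<subseteq> S" "Y1 \<subseteq> T" "X \<union> X1 \<subseteq> S" "Y \<inter> Y1 \<subseteq> T"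
    "T0 \<subseteq> T - (Y \<inter> Y1)" "X \<inter> X1 \<subseteq> S" "Y \<union> Y1 \<subseteq> T" "T0 \<subseteq> T - Y"
    using assms unfolding tight_triple_def tight_pair_def by auto
  let ?Z = "X1 - (X \<union> \<Gamma> T0)"
  have "card ?Z = card ((\<lambda>x. (x, t0)) ` ?Z)"
    by (rule card_image[symmetric]) (auto simp: inj_on_def)
  also have "\<dots> \<le> card ((X1 - X) \<times> (Y1 - Y) - F)"
  proof (rule card_mono)
    show "finite ((X1 - X) \<times> (Y1 - Y) - F)"
      using sub fin_S fin_T by (meson finite_Diff finite_SigmaI finite_subset)
    show "(\<lambda>x. (x, t0)) ` ?Z \<subseteq> (X1 - X) \<times> (Y1 - Y) - F"
      using t0 sub by auto
  qed
  finally have "card ?Z \<le> card ((X1 - X) \<times> (Y1 - Y) - F)" .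
  moreover have "r ((X \<union> \<Gamma> T0) \<union> ?Z) \<le> r (X \<union> \<Gamma> T0) + card ?Z"
    using sub \<Gamma>_subset by (intro rank_Un_le) auto
  moreover have "(X \<union> \<Gamma> T0) \<union> ?Z = (X \<union> X1) \<union> \<Gamma> T0"
    by auto
  ultimately show ?thesis
    using h_uncross[OF sub(1-4)] slack_ge[OF sub(5-7)] slack_nonneg[OF sub(8,9)] assms sub
    unfolding tight_triple_def tight_pair_def by auto
qed

text \<open>\<open>T0\<close> avoids \<open>Y \<union> Y1\<close>, so it bounds the slack of
  \<open>(X \<inter> X1, Y \<union> Y1)\<close> from below, by at least \<open>h X Y\<close> since
  rank is monotone. This leaves slack 0 for the other pair.\<close>

lemma tight_pair_Un_triple:
  assumes "tight_triple X Y T0" "tight_pair X1 Y1" "T0 \<inter> Y1 = {}"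
  shows "tight_pair (X \<union> X1) (Y \<inter> Y1)"
proof -
  have sub: "X \<subseteq> S" "Y \<subseteq> T" "X1 \<subseteq> S" "Y1 \<subseteq> T" "X \<union> X1 \<subseteq> S" "Y \<inter> Y1 \<subseteq> T"
    "X \<inter> X1 \<subseteq> S" "Y \<union> Y1 \<subseteq> T" "T0 \<subseteq> T - (Y \<union> Y1)"
    using assms unfolding tight_triple_def tight_pair_def by auto
  have "r ((X \<inter> X1) \<union> \<Gamma> T0) \<le> r (X \<union> \<Gamma> T0)"
    using sub \<Gamma>_subset by (intro rank_mono) auto
  then show ?thesis
    using h_uncross[OF sub(1-4)] slack_nonneg[OF sub(5,6)] slack_ge[OF sub(7-9)] assms sub
    unfolding tight_triple_def tight_pair_def by auto
qed

section \<open>Choosing an unblocked edge\<close>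

text \<open>Only constraints with \<open>s \<notin> X\<close> and \<open>t \<notin> Y\<close> lose
  slack when st joins \<open>F\<close>. No tight pair can afford this; a tight triple can if its
  rank rises in exchange.\<close>

definition unblocked :: "'a \<Rightarrow> 'a \<Rightarrow> bool" where
  "unblocked s t \<longleftrightarrow>
    (\<forall>X Y. tight_pair X Y \<longrightarrow> s \<notin> X \<longrightarrow> t \<in> Y) \<and>
    (\<forall>X Y T0. tight_triple X Y T0 \<longrightarrow> s \<notin> X \<longrightarrow> t \<notin> Y \<longrightarrow>
       t \<in> T0 \<and> r (insert s (X \<union> \<Gamma> T0)) \<noteq> r (X \<union> \<Gamma> T0))"

lemma slack_insert_left:
  assumes "X \<subseteq> S" "Y \<subseteq> T" "s \<notin> X"
  shows "h (insert s X) Y = h X Y - int (mS s) + int (card ({s} \<times> Y - F))"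
proof -
  have fin: "finite X" "finite Y"
    using assms fin_S fin_T finite_subset by auto
  have "insert s X \<times> Y - F = (X \<times> Y - F) \<union> ({s} \<times> Y - F)"
    by auto
  moreover have "(X \<times> Y - F) \<inter> ({s} \<times> Y - F) = {}"
    using assms by auto
  ultimately have "card (insert s X \<times> Y - F) = card (X \<times> Y - F) + card ({s} \<times> Y - F)"
    using fin by (simp add: card_Un_disjoint)
  then show ?thesis
    unfolding slack_def using fin assms by simp
qed

lemma slack_remove_right:
  assumes "X \<subseteq> S" "Y \<subseteq> T" "t \<in> Y"
  shows "h X (Y - {t}) = h X Y + int (mT t) - int (card (X \<times> {t} - F))"
proof -
  have fin: "finite X" "finite Y"
    using assms fin_S fin_T finite_subset by auto
  have "X \<times> Y - F = (X \<times> (Y - {t}) - F) \<union> (X \<times> {t} - F)"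
    using assms by auto
  moreover have "(X \<times> (Y - {t}) - F) \<inter> (X \<times> {t} - F) = {}"
    by auto
  ultimately have "card (X \<times> Y - F) = card (X \<times> (Y - {t}) - F) + card (X \<times> {t} - F)"
    using fin by (simp add: card_Un_disjoint)
  then show ?thesis
    unfolding slack_def using fin assms by (simp add: sum.remove[of Y t])
qed

text \<open>Tight pairs force \<open>t\<close> into a smallest \<open>Y1\<close>. Then only triples
  in \<open>L\<close> matter. Either there are none, or some has \<open>s\<close> in the closure of
  \<open>X \<union> \<Gamma> T0\<close>, which forces \<open>t\<close> into its \<open>Y\<close>, or
  \<open>t\<close> is taken from a smallest \<open>T0 \<inter> Y1\<close>.\<close>

lemma exists_unblocked:
  assumes s: "s \<in> S" "0 < mS s"
  obtains t where "t \<in> T" "(s, t) \<notin> F" "0 < mT t" "unblocked s t"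
proof -
  have "h {} T = 0"
    using arg_cong[OF sum_mT, of int] unfolding slack_def by simp
  then have "tight_pair {} T"
    unfolding tight_pair_def by auto
  then have "\<exists>X. tight_pair X T \<and> s \<notin> X"
    by blast
  \<comment> \<open>These sets \<open>Y\<close> are closed under intersection, so one of least
    cardinality lies in all the others.\<close>
  from ex_has_least_nat[of "\<lambda>Y. \<exists>X. tight_pair X Y \<and> s \<notin> X", OF this, of card]
  obtain X1 Y1 where tp: "tight_pair X1 Y1" and sX1: "s \<notin> X1"
    and least: "\<And>X Y. tight_pair X Y \<Longrightarrow> s \<notin> X \<Longrightarrow> card Y1 \<le> card Y"
    by blast
  have sub1: "X1 \<subseteq> S" "Y1 \<subseteq> T" and h1: "h X1 Y1 = 0"
    using tp unfolding tight_pair_def by auto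
  have finY1: "finite Y1"
    using sub1 fin_T finite_subset by auto
  have Y1_le: "Y1 \<subseteq> Y" if "tight_pair X Y" "s \<notin> X" for X Y
  proof -
    have "card Y1 \<le> card (Y1 \<inter> Y)"
      using least[OF tight_pair_uncross[OF tp that(1)]] that sX1 by auto
    then show ?thesis
      using finY1 by (metis card_seteq inf.absorb_iff1 inf_le1)
  qed
  \<comment> \<open>If \<open>mT t = 0\<close>, deleting \<open>t\<close> from \<open>Y1\<close>
    would not increase the slack, against minimality.\<close>
  have mT_pos: "0 < mT t" if "t \<in> Y1" for t
  proof (rule ccontr)
    assume "\<not> 0 < mT t"
    moreover have "0 \<le> h X1 (Y1 - {t})"
      using sub1 by (intro slack_nonneg) auto
    ultimately have "tight_pair X1 (Y1 - {t})"
      using slack_remove_right[OF sub1 that] h1 sub1 unfolding tight_pair_def by auto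
    then show False
      using Y1_le[of X1 "Y1 - {t}"] sX1 that by auto
  qed
  \<comment> \<open>Adding \<open>s\<close> to \<open>X\<close> costs \<open>mS s > 0\<close>; only
    edges of G_0 from \<open>s\<close> into \<open>Y\<close> can make up for it.\<close>
  have edge: "\<exists>t\<in>Y. (s, t) \<notin> F" if "X \<subseteq> S" "Y \<subseteq> T" "s \<notin> X" "h X Y \<le> h (insert s X) Y" for X Y
  proof -
    have "card ({s} \<times> Y - F) \<noteq> 0"
      using slack_insert_left[OF that(1-3)] that(4) s by linarith
    then have "{s} \<times> Y - F \<noteq> {}"
      by force
    then show ?thesis
      by auto
  qed
  define L where "L X Y T0 \<longleftrightarrow> tight_triple X Y T0 \<and> s \<notin> X \<and> T0 \<inter> Y1 \<noteq> {}" for X Y T0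
  \<comment> \<open>If \<open>T0\<close> misses \<open>Y1\<close>, uncrossing with
    \<open>(X1, Y1)\<close> gives a tight pair, so such a triple cannot block any
    \<open>t \<in> Y1\<close>.\<close>
  have not_L: "Y1 \<subseteq> Y" if "tight_triple X Y T0" "s \<notin> X" "\<not> L X Y T0" for X Y T0
  proof -
    have "tight_pair (X \<union> X1) (Y \<inter> Y1)"
      using that by (intro tight_pair_Un_triple[OF _ tp]) (auto simp: L_def)
    then show ?thesis
      using Y1_le that(2) sX1 by blast
  qed
  have unblocked: "unblocked s t" if "t \<in> Y1"
    and "\<And>X Y T0. L X Y T0 \<Longrightarrow> t \<notin> Y \<Longrightarrow> t \<in> T0 \<and> r (insert s (X \<union> \<Gamma> T0)) \<noteq> r (X \<union> \<Gamma> T0)" for t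
    unfolding unblocked_def using that Y1_le not_L by blast
  show thesis
  proof (cases "\<exists>X Y T0. L X Y T0")
    case False
    have "h X1 Y1 \<le> h (insert s X1) Y1"
      unfolding h1 using sub1 s by (intro slack_nonneg) auto
    then obtain t where "t \<in> Y1" "(s, t) \<notin> F"
      using edge sub1 sX1 by meson
    then show thesis
      using that mT_pos unblocked False sub1 by blast
  next
    case ex_L: True
    show thesis
    proof (cases "\<exists>X Y T0. L X Y T0 \<and> r (insert s (X \<union> \<Gamma> T0)) = r (X \<union> \<Gamma> T0)")
      case True
      \<comment> \<open>For these triples the rank cannot rise, so \<open>t \<in> Y\<close> is
        required. A smallest such \<open>Y\<close> will lie in the second set of every triple in
        \<open>L\<close>.\<close>
      let ?P = "\<lambda>Y. \<exists>X T0. L X Y T0 \<and> r (insert s (X \<union> \<Gamma> T0)) = r (X \<union> \<Gamma> T0)"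
      from True obtain Y0 where "?P Y0"
        by blast
      from ex_has_least_nat[of ?P, OF this, of card]
      obtain X Y T0 where XYT: "L X Y T0" and cl: "r (insert s (X \<union> \<Gamma> T0)) = r (X \<union> \<Gamma> T0)"
        and least_Y: "\<And>X' Y' T0'. L X' Y' T0' \<Longrightarrow>
          r (insert s (X' \<union> \<Gamma> T0')) = r (X' \<union> \<Gamma> T0') \<Longrightarrow> card Y \<le> card Y'"
        by blast
      have tt: "tight_triple X Y T0" and sX: "s \<notin> X"
        using XYT unfolding L_def by auto
      have sub: "X \<subseteq> S" "Y \<subseteq> T" "T0 \<subseteq> T - Y"
        using tt unfolding tight_triple_def by auto
      have finY: "finite Y"
        using finite_subset[OF sub(2) fin_T] .
      \<comment> \<open>Enlarging \<open>X\<close> and \<open>T0\<close> keeps \<open>s\<close> in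
        the closure, so minimality of \<open>Y\<close> applies to
        \<open>Y \<inter> Y'\<close>.\<close>
      have join: "Y \<subseteq> Y'" if "L X' (Y \<inter> Y') T0'" "X \<subseteq> X'" "T0 \<subseteq> T0'" for X' Y' T0'
      proof -
        have "X' \<subseteq> S"
          using that(1) unfolding L_def tight_triple_def by auto
        then have "r (insert s (X' \<union> \<Gamma> T0')) = r (X' \<union> \<Gamma> T0')"
          using that \<Gamma>_subset s by (intro rank_insert_eq_mono[OF cl]) auto
        from least_Y[OF that(1) this] show ?thesis
          using finY by (metis card_seteq inf.absorb_iff1 inf_le1)
      qed
      have "L (X \<union> X1) (Y \<inter> Y1) T0"
        using tight_triple_Un_pair[OF tt tp] XYT sX1 unfolding L_def by auto
      then have "Y \<subseteq> Y1"
        using join by blast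
      have min_Y: "Y \<subseteq> Y'" if "L X' Y' T0'" for X' Y' T0'
      proof -
        have "L (X \<union> X') (Y \<inter> Y') (T0 \<union> T0')"
          using tight_triple_uncross(1)[OF tt, of X' Y' T0'] that XYT unfolding L_def by auto
        then show ?thesis
          using join by blast
      qed
      \<comment> \<open>Adding \<open>s\<close> leaves the rank unchanged, so the lower bound for
        the enlarged triple is again \<open>h X Y\<close>.\<close>
      have "h X Y \<le> h (insert s X) Y"
        using slack_ge[of "insert s X" Y T0] sub s cl tt unfolding tight_triple_def by auto
      then obtain t where "t \<in> Y" "(s, t) \<notin> F"
        using edge sub sX by meson
      moreover have "unblocked s t"
        using \<open>t \<in> Y\<close> \<open>Y \<subseteq> Y1\<close> min_Y by (intro unblocked) blast+
      ultimately show thesis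
        using that mT_pos \<open>Y \<subseteq> Y1\<close> sub1 by blast
    next
      case notcl: False
      from ex_L obtain T0' where "\<exists>X Y. L X Y T0'"
        by blast
      \<comment> \<open>For every triple in \<open>L\<close> the rank now rises with
        \<open>s\<close>, so \<open>t\<close> only has to lie in its second or third set.\<close>
      from ex_has_least_nat[of "\<lambda>T0. \<exists>X Y. L X Y T0", OF this, of "\<lambda>T0. card (T0 \<inter> Y1)"]
      obtain X Y T0 where XYT: "L X Y T0"
        and least_T0: "\<And>X' Y' T0'. L X' Y' T0' \<Longrightarrow> card (T0 \<inter> Y1) \<le> card (T0' \<inter> Y1)"
        by blast
      then obtain t where t: "t \<in> T0" "t \<in> Y1"
        unfolding L_def by auto
      have tt: "tight_triple X Y T0" and sX: "s \<notin> X" and tY: "t \<notin> Y"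
        using XYT t unfolding L_def tight_triple_def by auto
      \<comment> \<open>Otherwise \<open>s\<close> would trivially be in the closure of
        \<open>X \<union> \<Gamma> T0\<close>.\<close>
      have "s \<notin> \<Gamma> T0"
        using notcl XYT by (metis UnCI insert_absorb)
      then have "(s, t) \<notin> F"
        using t by auto
      moreover have "unblocked s t"
      proof (rule unblocked[OF t(2)])
        fix X' Y' T0' assume L': "L X' Y' T0'" "t \<notin> Y'"
        have "t \<in> T0'"
        proof (rule ccontr)
          assume nt: "t \<notin> T0'"
          \<comment> \<open>\<open>T0 \<inter> T0'\<close> meets \<open>Y1\<close> in fewer
            vertices, so this triple is outside \<open>L\<close> and its second set must contain
            \<open>Y1\<close>, although \<open>t\<close> is missing from it.\<close>
          have meet: "tight_triple (X \<inter> X') (Y \<union> Y') (T0 \<inter> T0')"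
            using tight_triple_uncross(2)[OF tt] L' unfolding L_def by auto
          have "card ((T0 \<inter> T0') \<inter> Y1) < card (T0 \<inter> Y1)"
            using t nt finY1 by (intro psubset_card_mono) auto
          then have "\<not> L (X \<inter> X') (Y \<union> Y') (T0 \<inter> T0')"
            using least_T0 by force
          then have "Y1 \<subseteq> Y \<union> Y'"
            using not_L meet sX by blast
          then show False
            using t tY L' by auto
        qed
        then show "t \<in> T0' \<and> r (insert s (X' \<union> \<Gamma> T0')) \<noteq> r (X' \<union> \<Gamma> T0')"
          using notcl L' by blast
      qed
      ultimately show thesis
        using that mT_pos t sub1 by blast
    qed
  qed
qed

text \<open>By integrality, a constraint that is not tight survives the loss of one; a tight triple
  that loses slack is compensated by its rank.\<close>

lemma feasible_insert:
  assumes st: "s \<in> S" "(s, t) \<notin> F" "0 < mS s" "0 < mT t" and ub: "unblocked s t"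
  shows "matroid_supermodular.feasible S T r p
    (insert (s, t) F) (mS(s := mS s - 1)) (mT(t := mT t - 1)) (g - 1)"
  unfolding feasible_def
proof (intro conjI allI impI)
  \<comment> \<open>\<open>g - 1\<close> is truncated subtraction on naturals.\<close>
  have g: "0 < g"
    using st(1,3) fin_S sum_mS by (metis gr0I not_less_zero sum_eq_0_iff)
  fix X Y assume XY: "X \<subseteq> S" "Y \<subseteq> T"
  then have "finite X" "finite Y"
    using fin_S fin_T finite_subset by auto
  note ins = slack_insert[of X Y s t F mS mT g, OF this st(2-) g]
  have "h X Y \<noteq> 0" if "s \<notin> X \<and> t \<notin> Y"
    using ub that XY unfolding unblocked_def tight_pair_def by blast
  then show "0 \<le> slack (insert (s, t) F) (mS(s := mS s - 1)) (mT(t := mT t - 1)) (g - 1) X Y"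
    unfolding ins using slack_nonneg[OF XY] by auto
  fix T0 assume T0: "T0 \<subseteq> T - Y"
  have sub: "X \<union> \<Gamma> T0 \<subseteq> S"
    using XY \<Gamma>_subset by auto
  have "r (X \<union> \<Gamma> T0) \<le> r (insert s (X \<union> \<Gamma> T0))"
    using sub st by (intro rank_mono) auto
  moreover have "X \<union> (insert (s, t) F)\<inverse> `` T0 = (if t \<in> T0 then insert s (X \<union> \<Gamma> T0) else X \<union> \<Gamma> T0)"
    by auto
  moreover have "t \<in> T0 \<and> r (insert s (X \<union> \<Gamma> T0)) \<noteq> r (X \<union> \<Gamma> T0)"
    if "s \<notin> X" "t \<notin> Y" "h X Y = p T0 - int (r (X \<union> \<Gamma> T0))"
    using ub that XY T0 unfolding unblocked_def tight_triple_def by blast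
  moreover have "p T0 - int (r (X \<union> \<Gamma> T0)) \<le> h X Y"
    using slack_ge[OF XY T0] .
  ultimately show "p T0 - int (r (X \<union> (insert (s, t) F)\<inverse> `` T0))
      \<le> slack (insert (s, t) F) (mS(s := mS s - 1)) (mT(t := mT t - 1)) (g - 1) X Y"
    unfolding ins by (cases "s \<notin> X \<and> t \<notin> Y"; cases "t \<in> T0") (auto simp: order_less_le)
qed

end

section \<open>Effect of one edge on degrees\<close>

lemma neighbours_eq_Image: "neighbours E Y = (set_mset E)\<inverse> `` Y"
  unfolding neighbours_def by auto

lemma degree_add_mset:
  "degree (add_mset (s, t) E) v = degree E v + of_bool (v = s \<or> v = t)"
  unfolding degree_def by auto

text \<open>Disjointness makes each end count in its own class only; positivity guards the truncated
  decrements.\<close>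

lemma fits_add_mset:
  assumes "S \<inter> T = {}" "s \<in> S" "t \<in> T"
  shows "fits S T (add_mset (s, t) E) mS mT \<longleftrightarrow>
    0 < mS s \<and> 0 < mT t \<and> fits S T E (mS(s := mS s - 1)) (mT(t := mT t - 1))"
proof -
  have "\<And>x. x \<in> S \<Longrightarrow> x \<noteq> t" "\<And>x. x \<in> T \<Longrightarrow> x \<noteq> s"
    using assms by auto
  then show ?thesis
    using assms unfolding fits_def degree_add_mset by (auto split: if_splits)
qed

lemma sum_decrement_eq:
  fixes f :: "'a \<Rightarrow> nat"
  assumes "finite A" "x \<in> A" "0 < f x" "sum f A = g"
  shows "0 < g" "sum (f(x := f x - 1)) A = g - 1"
proof -
  have "sum f A = f x + sum f (A - {x})"
    using assms by (simp add: sum.remove)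
  moreover have "sum (f(x := f x - 1)) A = (f x - 1) + sum f (A - {x})"
    using assms by (simp add: sum.remove)
  ultimately show "0 < g" "sum (f(x := f x - 1)) A = g - 1"
    using assms by auto
qed

section \<open>Both directions by induction\<close>

context matroid_supermodular
begin

text \<open>Induction on \<open>g\<close>: the unblocked edge joins \<open>F\<close> for the
  recursive call and is then credited to \<open>E\<close>, which leaves the sum \<open>E + F\<close>
  unchanged.\<close>

lemma feasible_imp_realizable:
  assumes "S \<inter> T = {}"
    and "bigraph S T F" "simple F" "feasible (set_mset F) mS mT g"
    and "(\<Sum>s\<in>S. mS s) = g" "(\<Sum>t\<in>T. mT t) = g"
  shows "\<exists>E. bigraph S T E \<and> fits S T E mS mT \<and> simple (E + F) \<and> matroid_covers r T (E + F) p"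
  using assms(2-)
proof (induction g arbitrary: F mS mT)
  case 0
  have zero: "mS s = 0" if "s \<in> S" for s
    using that 0 fin_S by simp
  have zero': "mT t = 0" if "t \<in> T" for t
    using that 0 fin_T by simp
  have "p Y \<le> int (r (neighbours F Y))" if "Y \<subseteq> T" for Y
  proof -
    \<comment> \<open>With \<open>X\<close> and \<open>Y\<close> empty and \<open>g = 0\<close> the
      slack is 0, so H_0 alone covers \<open>p\<close>.\<close>
    have "p Y - int (r ({} \<union> (set_mset F)\<inverse> `` Y)) \<le> slack (set_mset F) mS mT 0 {} {}"
      using that by (intro feasibleD(2)[OF 0(3)]) auto
    then show ?thesis
      by (simp add: slack_def neighbours_eq_Image)
  qed
  then show ?case
    using 0 zero zero'
    by (intro exI[of _ "{#}"]) (auto simp: bigraph_def fits_def degree_def matroid_covers_def)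
next
  case (Suc g)
  interpret feasible_instance S T r p "set_mset F" mS mT "Suc g"
    using Suc.prems by unfold_locales (auto simp: bigraph_def)
  obtain s where s: "s \<in> S" "0 < mS s"
    using Suc.prems(4) by (metis gr0I sum.neutral nat.distinct(1))
  obtain t where t: "t \<in> T" "(s, t) \<notin># F" "0 < mT t" "unblocked s t"
    using exists_unblocked[OF s] .
  let ?F = "add_mset (s, t) F" and ?mS = "mS(s := mS s - 1)" and ?mT = "mT(t := mT t - 1)"
  have "bigraph S T ?F"
    using Suc.prems(1) s t by (auto simp: bigraph_def)
  moreover have "simple ?F"
    using Suc.prems(2) t(2) by (auto simp: simple_def not_in_iff)
  moreover have "feasible (set_mset ?F) ?mS ?mT g"
    using feasible_insert[OF s(1) t(2) s(2) t(3,4)] by simp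
  moreover have "(\<Sum>s\<in>S. ?mS s) = g" "(\<Sum>t\<in>T. ?mT t) = g"
    using sum_decrement_eq(2)[OF fin_S s Suc.prems(4)] sum_decrement_eq(2)[OF fin_T t(1,3) Suc.prems(5)]
    by auto
  ultimately obtain E where "bigraph S T E" "fits S T E ?mS ?mT" "simple (E + ?F)"
    "matroid_covers r T (E + ?F) p"
    using Suc.IH by blast
  then show ?case
    using s t assms(1) by (intro exI[of _ "add_mset (s, t) E"]) (auto simp: fits_add_mset bigraph_def)
qed

text \<open>Induction on \<open>E\<close>, whose edges move into \<open>F\<close> one at a time. For
  empty \<open>E\<close> all degrees vanish and H_0 alone covers \<open>p\<close>; enlarging
  \<open>X\<close> only increases the rank.\<close>

lemma realizable_imp_feasible:
  assumes "S \<inter> T = {}"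
    and "bigraph S T F" "bigraph S T E" "fits S T E mS mT" "simple (E + F)"
      "matroid_covers r T (E + F) p"
    and "(\<Sum>s\<in>S. mS s) = g" "(\<Sum>t\<in>T. mT t) = g"
  shows "feasible (set_mset F) mS mT g"
  using assms(2-)
proof (induction E arbitrary: F mS mT g)
  case empty
  have zero: "mS s = 0" if "s \<in> S" for s
    using that empty by (auto simp: fits_def degree_def)
  have zero': "mT t = 0" if "t \<in> T" for t
    using that empty by (auto simp: fits_def degree_def)
  have slack: "0 \<le> slack (set_mset F) mS mT g X Y" if "X \<subseteq> S" "Y \<subseteq> T" for X Y
  proof -
    have "(\<Sum>s\<in>X. int (mS s)) = 0" "(\<Sum>t\<in>Y. int (mT t)) = 0"
      using that zero zero' by (auto intro!: sum.neutral)
    then show ?thesis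
      by (simp add: slack_def)
  qed
  have "p T0 \<le> int (r (X \<union> (set_mset F)\<inverse> `` T0))" if "X \<subseteq> S" "T0 \<subseteq> T" for X T0
  proof -
    have "p T0 \<le> int (r ((set_mset F)\<inverse> `` T0))"
      using empty that by (auto simp: matroid_covers_def neighbours_eq_Image)
    moreover have "r ((set_mset F)\<inverse> `` T0) \<le> r (X \<union> (set_mset F)\<inverse> `` T0)"
      using empty(1) that by (intro rank_mono) (auto simp: bigraph_def)
    ultimately show ?thesis
      by linarith
  qed
  then show ?case
    using slack unfolding feasible_def by (smt (verit) Diff_subset order_trans)
next
  case (add e E)
  obtain s t where e: "e = (s, t)"
    by (cases e)
  have st: "s \<in> S" "t \<in> T"
    using add.prems(2) by (auto simp: e bigraph_def)
  have pos: "0 < mS s" "0 < mT t"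
    and fits: "fits S T E (mS(s := mS s - 1)) (mT(t := mT t - 1))"
    using add.prems(3) fits_add_mset[OF assms(1) st] unfolding e by auto
  have "count (add_mset (s, t) E + F) (s, t) \<le> 1"
    using add.prems(4) unfolding e simple_def by blast
  then have notin: "(s, t) \<notin># F"
    by (auto simp: not_in_iff)
  have "feasible (set_mset (add_mset (s, t) F)) (mS(s := mS s - 1)) (mT(t := mT t - 1)) (g - 1)"
  proof (rule add.IH)
    show "bigraph S T (add_mset (s, t) F)" "bigraph S T E"
      using add.prems(1,2) st by (auto simp: bigraph_def)
    show "simple (E + add_mset (s, t) F)" "matroid_covers r T (E + add_mset (s, t) F) p"
      using add.prems(4,5) by (auto simp: e)
  qed (fact fits sum_decrement_eq(2)[OF fin_S st(1) pos(1) add.prems(6)]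
      sum_decrement_eq(2)[OF fin_T st(2) pos(2) add.prems(7)])+
  then have "feasible (insert (s, t) (set_mset F))
      (mS(s := mS s - 1)) (mT(t := mT t - 1)) (g - 1)"
    unfolding set_mset_add_mset_insert .
  moreover have "set_mset F \<subseteq> S \<times> T"
    using add.prems(1) unfolding bigraph_def .
  ultimately show ?case
    using st(1) notin pos sum_decrement_eq(1)[OF fin_S st(1) pos(1) add.prems(6)]
    by (rule feasible_remove_edge)
qed

end

section \<open>Passage to the bipartite complement\<close>

lemma edges_between_bip_complement:
  assumes "finite S" "finite T" "X \<subseteq> S" "Y \<subseteq> T"
  shows "edges_between (bip_complement S T F) X Y = card (X \<times> Y - set_mset F)"
proof -
  have "{e \<in> S \<times> T - set_mset F. fst e \<in> X \<and> snd e \<in> Y} = X \<times> Y - set_mset F"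
    using assms by auto
  then show ?thesis
    using assms by (simp add: edges_between_def bip_complement_def)
qed

theorem theorem5:
  fixes S T :: "'a set"
    and F\<^sub>0 G\<^sub>0 :: "'a edges"
    and r\<^sub>S :: "'a set \<Rightarrow> nat"
    and p\<^sub>T :: "'a set \<Rightarrow> int"
    and m\<^sub>S m\<^sub>T :: "'a \<Rightarrow> nat"
    and \<gamma> :: nat
  assumes "finite S" "S \<noteq> {}" "finite T" "T \<noteq> {}" "S \<inter> T = {}"
    and "bigraph S T F\<^sub>0" "simple F\<^sub>0"
    and "G\<^sub>0 = bip_complement S T F\<^sub>0"
    and "matroid S r\<^sub>S"
    and "fully_supermodular T p\<^sub>T"
    and "(\<Sum>s\<in>S. m\<^sub>S s) = \<gamma>" "(\<Sum>t\<in>T. m\<^sub>T t) = \<gamma>"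
  shows "(\<exists>E. bigraph S T E \<and> fits S T E m\<^sub>S m\<^sub>T \<and> simple (E + F\<^sub>0)
              \<and> matroid_covers r\<^sub>S T (E + F\<^sub>0) p\<^sub>T)
    \<longleftrightarrow>
      (\<forall>X Y. X \<subseteq> S \<longrightarrow> Y \<subseteq> T \<longrightarrow>
         int (\<Sum>s\<in>X. m\<^sub>S s) + int (\<Sum>t\<in>Y. m\<^sub>T t) - int (edges_between G\<^sub>0 X Y) \<le> int \<gamma>)
    \<and> (\<forall>X Y T\<^sub>0. X \<subseteq> S \<longrightarrow> Y \<subseteq> T \<longrightarrow> T\<^sub>0 \<subseteq> T - Y \<longrightarrow>
         int (\<Sum>s\<in>X. m\<^sub>S s) + int (\<Sum>t\<in>Y. m\<^sub>T t) - int (edges_between G\<^sub>0 X Y)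
           + p\<^sub>T T\<^sub>0 - int (r\<^sub>S (X \<union> neighbours F\<^sub>0 T\<^sub>0)) \<le> int \<gamma>)"
    (is "?L \<longleftrightarrow> ?R")
proof -
  interpret matroid_supermodular S T r\<^sub>S p\<^sub>T
    using assms by unfold_locales
  have slack: "slack (set_mset F\<^sub>0) m\<^sub>S m\<^sub>T \<gamma> X Y =
      int \<gamma> - int (\<Sum>s\<in>X. m\<^sub>S s) - int (\<Sum>t\<in>Y. m\<^sub>T t) + int (edges_between G\<^sub>0 X Y)"
    if "X \<subseteq> S" "Y \<subseteq> T" for X Y
    using edges_between_bip_complement[OF assms(1,3) that, of F\<^sub>0] assms(8)
    by (simp add: slack_def)
  have "feasible (set_mset F\<^sub>0) m\<^sub>S m\<^sub>T \<gamma> \<longleftrightarrow> ?R"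
    unfolding feasible_def neighbours_eq_Image
    by (intro arg_cong2[where f = "(\<and>)"] all_cong1 imp_cong refl) (auto simp: slack)
  then show ?thesis
    using feasible_imp_realizable[OF assms(5-7) _ assms(11,12)]
      realizable_imp_feasible[OF assms(5,6) _ _ _ _ assms(11,12)] by blast
qed

end
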